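(* Let $A$ be a residuated lattice and $m$ an infinite cardinal. Then the following are equivalent: (I) for each non-empty subset $X$ of $A$ with $|X|\leq m$, there exists an element $e\in B(A)$ such that $X^{\top}=\langle e\rangle$; (II) $A$ is a co-Stone residuated lattice and $B(A)$ is an $m$-complete Boolean algebra; (III) $A_{\top\top}=\{a^{\top\top}\mid a\in A\}$ is an $m$-complete Boolean sublattice of $\mathcal{F}(A)$; (IV) for all $a,b\in A$, $(a\vee b)^{\top}=a^{\top}\vee b^{\top}$, and, for each non-empty subset $X$ of $A$ with $|X|\leq m$, there exists an element $x\in A$ such that $X^{\top\top}=x^{\top}$; (V) for each non-empty subset $X$ of $A$ with $|X|\leq m$, $X^{\top}\vee X^{\top\top}=A$.
   Context: A residuated lattice is an algebra $(A,\vee,\wedge,\odot,\rightarrow,0,1)$ such that $(A,\vee,\wedge,0,1)$ is a bounded lattice, $(A,\odot,1)$ is a commutative monoid, and $a\leq b\rightarrow c$ iff $a\odot b\leq c$ for all $a,b,c\in A$. A filter of $A$ is a non-empty subset closed under $\odot$ and upward closed. $\mathcal{F}(A)$ is the set of all filters, a bounded distributive lattice ordered by inclusion, with meet $\cap$, join $F\vee G$ = the filter generated by $F\cup G$, least element $\{1\}$ and greatest element $A$. $\langle x\rangle$ denotes the principal filter generated by $x$. $B(A)$ is the set of complemented elements of the bounded lattice $A$; it is a Boolean algebra. For $X\subseteq A$, $X^{\top}=\{a\in A\mid a\vee x=1\text{ for all }x\in X\}$ (a filter of $A$), $x^{\top}=\{x\}^{\top}$, $X^{\top\top}=(X^{\top})^{\top}$,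 $x^{\top\top}=(x^\top)^\top$. $A$ is co-Stone iff for every $x\in A$ there is $e\in B(A)$ with $x^{\top}=\langle e\rangle$. A lattice is $m$-complete iff every subset of cardinality at most $m$ has an infimum and a supremum in it. In (III), "$m$-complete Boolean sublattice of $\mathcal{F}(A)$" means: a sublattice of $\mathcal{F}(A)$ which, as a lattice, is a Boolean algebra and is $m$-complete. *)

theory Defs
  imports "HOL-Algebra.Group" "HOL.Hull"
begin

unbundle cardinal_syntax

section \<open>Boolean lattices, sublattices and m-completeness\<close>

definition complemented :: "('a, 'b) gorder_scheme \<Rightarrow> 'a set"
  where "complemented L = {x \<in> carrier L. \<exists>y \<in> carrier L.
     x \<squnion>\<^bsub>L\<^esub> y = \<top>\<^bsub>L\<^esub> \<and> x \<sqinter>\<^bsub>L\<^esub> y = \<bottom>\<^bsub>L\<^esub>}"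

locale boolean_lattice = bounded_lattice L for L (structure) +
  assumes meet_join_distrib:
      "\<lbrakk>x \<in> carrier L; y \<in> carrier L; z \<in> carrier L\<rbrakk>
         \<Longrightarrow> x \<sqinter> (y \<squnion> z) = (x \<sqinter> y) \<squnion> (x \<sqinter> z)"
    and complement_exists:
      "x \<in> carrier L \<Longrightarrow> \<exists>y \<in> carrier L. x \<squnion> y = \<top> \<and> x \<sqinter> y = \<bottom>"

definition sublattice :: "'a set \<Rightarrow> ('a, 'b) gorder_scheme \<Rightarrow> bool"
  where "sublattice S L \<longleftrightarrow> S \<subseteq> carrier L \<and>
     (\<forall>x \<in> S. \<forall>y \<in> S. x \<squnion>\<^bsub>L\<^esub> y \<in> S \<and> x \<sqinter>\<^bsub>L\<^esub> y \<in> S)"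

text \<open>A cardinal is a relation \<open>m\<close> with \<open>Card_order m\<close>, and \<open>|X| \<le>o m\<close> says that
  \<open>X\<close> has cardinality at most \<open>m\<close>.  Suprema and infima are those of \<open>L\<close> itself, so for
  \<open>L\<lparr>carrier := S\<rparr>\<close> they are taken inside \<open>S\<close>.\<close>

definition m_complete :: "'c rel \<Rightarrow> ('a, 'b) gorder_scheme \<Rightarrow> bool"
  where "m_complete m L \<longleftrightarrow> (\<forall>X. X \<subseteq> carrier L \<and> |X| \<le>o m \<longrightarrow>
     (\<exists>s. least L s (Upper L X)) \<and> (\<exists>i. greatest L i (Lower L X)))"

section \<open>Residuated lattices\<close>

text \<open>The lattice operations and bounds are those determined by the order; the constant \<open>1\<close>
  of a residuated lattice is its top element and \<open>0\<close> its bottom element.\<close>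

record 'a residuated = "'a gorder" +
  odot :: "['a, 'a] \<Rightarrow> 'a" (infixl \<open>\<odot>\<index>\<close> 70)
  residuum :: "['a, 'a] \<Rightarrow> 'a" (infixr \<open>\<rightharpoonup>\<index>\<close> 60)

locale residuated_lattice = bounded_lattice A for A (structure) +
  assumes odot_comm_monoid: "comm_monoid \<lparr>carrier = carrier A, mult = (\<odot>), one = \<top>\<rparr>"
    and residuum_closed: "\<lbrakk>a \<in> carrier A; b \<in> carrier A\<rbrakk> \<Longrightarrow> a \<rightharpoonup> b \<in> carrier A"
    and residuation: "\<lbrakk>a \<in> carrier A; b \<in> carrier A; c \<in> carrier A\<rbrakk>
       \<Longrightarrow> a \<sqsubseteq> b \<rightharpoonup> c \<longleftrightarrow> a \<odot> b \<sqsubseteq> c"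

abbreviation boolean_center :: "('a, 'b) residuated_scheme \<Rightarrow> ('a, 'b) residuated_scheme"
  where "boolean_center A \<equiv> A\<lparr>carrier := complemented A\<rparr>"

definition rl_filter :: "('a, 'b) residuated_scheme \<Rightarrow> 'a set \<Rightarrow> bool"
  where "rl_filter A F \<longleftrightarrow> F \<subseteq> carrier A \<and> F \<noteq> {} \<and>
     (\<forall>x \<in> F. \<forall>y \<in> F. x \<odot>\<^bsub>A\<^esub> y \<in> F) \<and>
     (\<forall>x \<in> F. \<forall>y \<in> carrier A. x \<sqsubseteq>\<^bsub>A\<^esub> y \<longrightarrow> y \<in> F)"

definition filter_gen :: "('a, 'b) residuated_scheme \<Rightarrow> 'a set \<Rightarrow> 'a set"
  where "filter_gen A X = rl_filter A hull X"

definition filter_join :: "('a, 'b) residuated_scheme \<Rightarrow> 'a set \<Rightarrow> 'a set \<Rightarrow> 'a set"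
  where "filter_join A F G = filter_gen A (F \<union> G)"

definition filter_lattice :: "('a, 'b) residuated_scheme \<Rightarrow> 'a set gorder"
  where "filter_lattice A = \<lparr>carrier = {F. rl_filter A F}, eq = (=), le = (\<subseteq>)\<rparr>"

definition coann :: "('a, 'b) residuated_scheme \<Rightarrow> 'a set \<Rightarrow> 'a set"
  where "coann A X = {a \<in> carrier A. \<forall>x \<in> X. a \<squnion>\<^bsub>A\<^esub> x = \<top>\<^bsub>A\<^esub>}"

locale co_Stone_residuated_lattice = residuated_lattice A for A (structure) +
  assumes co_Stone: "x \<in> carrier A \<Longrightarrow> \<exists>e \<in> complemented A. coann A {x} = filter_gen A {e}"

section \<open>Join and meet in the lattice of filters\<close>

lemma (in residuated_lattice) top_in_filter: "rl_filter A F \<Longrightarrow> \<top> \<in> F"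
  unfolding rl_filter_def using top_closed top_higher by blast

lemma (in residuated_lattice) odot_mono:
  assumes "a \<in> carrier A" "b \<in> carrier A" "c \<in> carrier A" "d \<in> carrier A" "a \<sqsubseteq> b" "c \<sqsubseteq> d"
  shows "a \<odot> c \<sqsubseteq> b \<odot> d"
proof -
  interpret M: comm_monoid "\<lparr>carrier = carrier A, mult = (\<odot>), one = \<top>\<rparr>"
    by (rule odot_comm_monoid)
  have cl: "x \<odot> y \<in> carrier A" if "x \<in> carrier A" "y \<in> carrier A" for x y
    using M.m_closed that by simp
  have comm: "x \<odot> y = y \<odot> x" if "x \<in> carrier A" "y \<in> carrier A" for x y
    using M.m_comm that by simp
  have mono: "x \<odot> z \<sqsubseteq> y \<odot> z"
    if "x \<in> carrier A" "y \<in> carrier A" "z \<in> carrier A" "x \<sqsubseteq> y" for x y z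
  proof -
    have "y \<sqsubseteq> z \<rightharpoonup> (y \<odot> z)"
      using residuation[of y z "y \<odot> z"] that cl by simp
    then have "x \<sqsubseteq> z \<rightharpoonup> (y \<odot> z)"
      using le_trans[OF that(4)] that(1-3) cl residuum_closed by simp
    then show ?thesis
      using residuation[of x z "y \<odot> z"] that cl by simp
  qed
  have "a \<odot> c \<sqsubseteq> b \<odot> c" using mono[of a b c] assms by simp
  moreover have "b \<odot> c \<sqsubseteq> b \<odot> d"
    using mono[of c d b] assms comm by simp
  ultimately show ?thesis by (rule le_trans) (use cl assms in simp_all)
qed

lemma (in residuated_lattice) rl_filter_carrier: "rl_filter A (carrier A)"
proof -
  interpret M: comm_monoid "\<lparr>carrier = carrier A, mult = (\<odot>), one = \<top>\<rparr>"
    by (rule odot_comm_monoid)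
  show ?thesis
    unfolding rl_filter_def using M.m_closed top_closed by auto
qed

lemma (in residuated_lattice) rl_filter_Inter:
  assumes "S \<noteq> {}" "\<And>F. F \<in> S \<Longrightarrow> rl_filter A F"
  shows "rl_filter A (\<Inter>S)"
proof -
  have "\<top> \<in> \<Inter>S" using assms top_in_filter by blast
  then show ?thesis using assms unfolding rl_filter_def by blast
qed

lemma (in residuated_lattice) rl_filter_gen:
  assumes "X \<subseteq> carrier A"
  shows "rl_filter A (filter_gen A X)"
  unfolding filter_gen_def hull_def using assms rl_filter_carrier by (intro rl_filter_Inter) auto

lemma (in residuated_lattice) filter_lattice_is_bounded_lattice:
    "bounded_lattice (filter_lattice A)"
  and filter_lattice_join: "\<lbrakk>rl_filter A F; rl_filter A G\<rbrakk>
     \<Longrightarrow> F \<squnion>\<^bsub>filter_lattice A\<^esub> G = filter_join A F G"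
  and filter_lattice_meet: "\<lbrakk>rl_filter A F; rl_filter A G\<rbrakk>
     \<Longrightarrow> F \<sqinter>\<^bsub>filter_lattice A\<^esub> G = F \<inter> G"
  and filter_lattice_bottom: "\<bottom>\<^bsub>filter_lattice A\<^esub> = {\<top>}"
  and filter_lattice_top: "\<top>\<^bsub>filter_lattice A\<^esub> = carrier A"
proof -
  let ?L = "filter_lattice A"
  interpret M: comm_monoid "\<lparr>carrier = carrier A, mult = (\<odot>), one = \<top>\<rparr>"
    by (rule odot_comm_monoid)
  have PO: "partial_order ?L"
    by unfold_locales (auto simp: filter_lattice_def)
  have sup2: "least ?L (filter_join A F G) (Upper ?L {F, G})"
    if "rl_filter A F" "rl_filter A G" for F G
  proof -
    have "F \<union> G \<subseteq> carrier A" using that unfolding rl_filter_def by blast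
    then have "rl_filter A (filter_join A F G)"
      unfolding filter_join_def by (rule rl_filter_gen)
    moreover have "F \<union> G \<subseteq> filter_join A F G"
      unfolding filter_join_def filter_gen_def by (rule hull_subset)
    moreover have "filter_join A F G \<subseteq> H" if "rl_filter A H" "F \<subseteq> H" "G \<subseteq> H" for H
      unfolding filter_join_def filter_gen_def using that by (intro hull_minimal) auto
    ultimately show ?thesis
      using that by (auto simp: least_def Upper_def filter_lattice_def)
  qed
  have inf2: "greatest ?L (F \<inter> G) (Lower ?L {F, G})"
    if "rl_filter A F" "rl_filter A G" for F G
  proof -
    have "rl_filter A (F \<inter> G)" using rl_filter_Inter[of "{F, G}"] that by auto
    then show ?thesis
      using that by (auto simp: greatest_def Lower_def filter_lattice_def)
  qed
  have "x = \<top>" if "x \<in> carrier A" "\<top> \<sqsubseteq> x" for x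
    using that top_higher le_antisym top_closed by blast
  moreover have "\<top> \<odot> \<top> = \<top>" using M.r_one[of \<top>] top_closed by simp
  ultimately have "rl_filter A {\<top>}"
    unfolding rl_filter_def using top_closed by auto
  then have bot: "least ?L {\<top>} (carrier ?L)"
    using top_in_filter by (auto simp: least_def filter_lattice_def)
  have top: "greatest ?L (carrier A) (carrier ?L)"
    using rl_filter_carrier by (auto simp: greatest_def filter_lattice_def rl_filter_def)
  interpret P: partial_order ?L by (rule PO)
  show BL: "bounded_lattice ?L"
  proof unfold_locales
    fix F G assume "F \<in> carrier ?L" "G \<in> carrier ?L"
    then have *: "rl_filter A F" "rl_filter A G" by (auto simp: filter_lattice_def)
    show "\<exists>s. least ?L s (Upper ?L {F, G})" using sup2[OF *] by blast
    show "\<exists>s. greatest ?L s (Lower ?L {F, G})" using inf2[OF *] by blast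
  next
    show "\<exists>x. least ?L x (carrier ?L)" using bot by blast
    show "\<exists>x. greatest ?L x (carrier ?L)" using top by blast
  qed
  show "F \<squnion>\<^bsub>?L\<^esub> G = filter_join A F G" if "rl_filter A F" "rl_filter A G"
    unfolding join_def sup_def
    by (rule some_equality, rule sup2[OF that]) (rule P.least_unique[OF _ sup2[OF that]])
  show "F \<sqinter>\<^bsub>?L\<^esub> G = F \<inter> G" if "rl_filter A F" "rl_filter A G"
    unfolding meet_def inf_def
    by (rule some_equality, rule inf2[OF that]) (rule P.greatest_unique[OF _ inf2[OF that]])
  show "\<bottom>\<^bsub>?L\<^esub> = {\<top>}"
    unfolding bottom_def by (rule some_equality, rule bot) (rule P.least_unique[OF _ bot])
  show "\<top>\<^bsub>?L\<^esub> = carrier A"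
    unfolding top_def by (rule some_equality, rule top) (rule P.greatest_unique[OF _ top])
qed

end

theory Submission
  imports Defs
begin

text \<open>If \<open>F\<close> and \<open>G\<close> are filters with \<open>F \<inter> G = {1}\<close> and \<open>F \<or> G = A\<close>, then \<open>f \<odot> g = 0\<close> for some
  \<open>f \<in> F\<close>, \<open>g \<in> G\<close>, while \<open>f \<or> g = 1\<close>; hence \<open>f\<close> and \<open>g\<close> are complements of each other and generate
  \<open>F\<close> and \<open>G\<close>. Since \<open>X\<^sup>\<top> \<inter> X\<^sup>\<top>\<^sup>\<top> = {1}\<close>, this gives (I) \<open>\<longleftrightarrow>\<close> (V), and the Boolean complements in
  (III) make \<open>A\<close> co-Stone. Under (IV), if \<open>X\<^sup>\<top>\<^sup>\<top> = x\<^sup>\<top>\<close> and \<open>x\<^sup>\<top>\<^sup>\<top> = y\<^sup>\<top>\<close>, then \<open>y \<in> x\<^sup>\<top>\<close> and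
  \<open>X\<^sup>\<top> \<or> X\<^sup>\<top>\<^sup>\<top> = y\<^sup>\<top> \<or> x\<^sup>\<top> = (y \<or> x)\<^sup>\<top> = A\<close>, which is (V). In a
  co-Stone residuated lattice \<open>e \<mapsto> \<langle>e\<rangle>\<close> is a dual isomorphism from \<open>B(A)\<close> onto \<open>A\<^sub>\<top>\<^sub>\<top>\<close>, which reduces (II) \<open>\<longleftrightarrow>\<close> (III) to a transfer of completeness.\<close>

section \<open>Bounded sublattices and dual isomorphisms\<close>

context bounded_lattice
begin

context
  fixes S
  assumes S: "sublattice S L" "\<top> \<in> S" "\<bottom> \<in> S"
begin

private lemma in_carrier: "x \<in> S \<Longrightarrow> x \<in> carrier L"
  using S(1) by (auto simp: sublattice_def)

private lemma sublattice_sup: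
  assumes "x \<in> S" "y \<in> S"
  shows "least (L\<lparr>carrier := S\<rparr>) (x \<squnion> y) (Upper (L\<lparr>carrier := S\<rparr>) {x, y})"
  using assms S(1) in_carrier
  by (auto simp: least_def Upper_def sublattice_def intro!: join_left join_right join_le)

private lemma sublattice_inf:
  assumes "x \<in> S" "y \<in> S"
  shows "greatest (L\<lparr>carrier := S\<rparr>) (x \<sqinter> y) (Lower (L\<lparr>carrier := S\<rparr>) {x, y})"
  using assms S(1) in_carrier
  by (auto simp: greatest_def Lower_def sublattice_def intro!: meet_left meet_right meet_le)

private lemma sublattice_bot: "least (L\<lparr>carrier := S\<rparr>) \<bottom> S"
  using S in_carrier by (auto simp: least_def bottom_lower)

private lemma sublattice_top: "greatest (L\<lparr>carrier := S\<rparr>) \<top> S"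
  using S in_carrier by (auto simp: greatest_def top_higher)

private lemma sublattice_partial_order: "partial_order (L\<lparr>carrier := S\<rparr>)"
  by unfold_locales
    (auto simp: eq_is_equal in_carrier intro: le_antisym[OF _ _ in_carrier in_carrier]
      le_trans[OF _ _ in_carrier in_carrier in_carrier])

lemma bounded_lattice_sublattice: "bounded_lattice (L\<lparr>carrier := S\<rparr>)"
proof -
  interpret P: partial_order "L\<lparr>carrier := S\<rparr>" by (rule sublattice_partial_order)
  show ?thesis
    by unfold_locales
      (simp_all, (blast intro: sublattice_sup sublattice_inf sublattice_bot sublattice_top)+)
qed

text \<open>The operations and bounds are chosen by \<open>SOME\<close> relative to the carrier, so
  shrinking the carrier gives new terms. The old values still satisfy the defining conditions inside
  \<open>S\<close>, and uniqueness of least and greatest elements identifies the two.\<close>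

lemma join_sublattice: "\<lbrakk>x \<in> S; y \<in> S\<rbrakk> \<Longrightarrow> x \<squnion>\<^bsub>L\<lparr>carrier := S\<rparr>\<^esub> y = x \<squnion> y"
  and meet_sublattice: "\<lbrakk>x \<in> S; y \<in> S\<rbrakk> \<Longrightarrow> x \<sqinter>\<^bsub>L\<lparr>carrier := S\<rparr>\<^esub> y = x \<sqinter> y"
  and bottom_sublattice: "\<bottom>\<^bsub>L\<lparr>carrier := S\<rparr>\<^esub> = \<bottom>"
  and top_sublattice: "\<top>\<^bsub>L\<lparr>carrier := S\<rparr>\<^esub> = \<top>"
proof -
  let ?M = "L\<lparr>carrier := S\<rparr>"
  interpret P: partial_order ?M by (rule sublattice_partial_order)
  show "x \<squnion>\<^bsub>?M\<^esub> y = x \<squnion> y" if "x \<in> S" "y \<in> S"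
    unfolding join_def[of ?M] sup_def[of ?M]
    by (rule some_equality, rule sublattice_sup[OF that])
      (rule P.least_unique[OF _ sublattice_sup[OF that]])
  show "x \<sqinter>\<^bsub>?M\<^esub> y = x \<sqinter> y" if "x \<in> S" "y \<in> S"
    unfolding meet_def[of ?M] inf_def[of ?M]
    by (rule some_equality, rule sublattice_inf[OF that])
      (rule P.greatest_unique[OF _ sublattice_inf[OF that]])
  show "\<bottom>\<^bsub>?M\<^esub> = \<bottom>"
    unfolding bottom_def[of ?M]
    by (rule some_equality, simp add: sublattice_bot)
      (rule P.least_unique[OF _ sublattice_bot], simp)
  show "\<top>\<^bsub>?M\<^esub> = \<top>"
    unfolding top_def[of ?M]
    by (rule some_equality, simp add: sublattice_top)
      (rule P.greatest_unique[OF _ sublattice_top], simp)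
qed

text \<open>Serves both for \<open>complemented A\<close> inside \<open>A\<close> and for the
  principal filters of complemented elements inside the lattice of filters. Distributivity is
  checked on \<open>S\<close> alone, since \<open>A\<close> itself may fail to be
  distributive.\<close>

lemma boolean_lattice_sublatticeI:
  assumes "\<And>x y z. \<lbrakk>x \<in> S; y \<in> S; z \<in> S\<rbrakk> \<Longrightarrow> x \<sqinter> (y \<squnion> z) = (x \<sqinter> y) \<squnion> (x \<sqinter> z)"
    and "\<And>x. x \<in> S \<Longrightarrow> \<exists>y \<in> S. x \<squnion> y = \<top> \<and> x \<sqinter> y = \<bottom>"
  shows "boolean_lattice (L\<lparr>carrier := S\<rparr>)"
proof -
  interpret M: bounded_lattice "L\<lparr>carrier := S\<rparr>" by (rule bounded_lattice_sublattice)
  have "x \<squnion> y \<in> S" "x \<sqinter> y \<in> S" if "x \<in> S" "y \<in> S" for x y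
    using that S(1) by (auto simp: sublattice_def)
  then show ?thesis
    using assms
    by unfold_locales (simp_all add: join_sublattice meet_sublattice bottom_sublattice
      top_sublattice cong: bex_cong)
qed

end

end

text \<open>The order-reversing surjection \<open>h\<close> carries upper bounds of \<open>Y\<close>
  to lower bounds of its image and conversely, so suprema and infima trade places.\<close>

lemma
  assumes "h ` carrier L = carrier M" "Y \<subseteq> carrier L"
    and anti: "\<And>x y. \<lbrakk>x \<in> carrier L; y \<in> carrier L\<rbrakk> \<Longrightarrow> h x \<sqsubseteq>\<^bsub>M\<^esub> h y \<longleftrightarrow> y \<sqsubseteq>\<^bsub>L\<^esub> x"
  shows greatest_Lower_dual_image: "s \<in> carrier L \<Longrightarrow>
      greatest M (h s) (Lower M (h ` Y)) \<longleftrightarrow> least L s (Upper L Y)"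
    and least_Upper_dual_image: "s \<in> carrier L \<Longrightarrow>
      least M (h s) (Upper M (h ` Y)) \<longleftrightarrow> greatest L s (Lower L Y)"
proof -
  have Y: "y \<in> carrier L" if "y \<in> Y" for y using that assms(2) by blast
  have mem: "h x \<in> carrier M" if "x \<in> carrier L" for x using that assms(1) by blast
  have bounds: "Upper L Y = {x \<in> carrier L. \<forall>y \<in> Y. y \<sqsubseteq>\<^bsub>L\<^esub> x}"
      "Lower L Y = {x \<in> carrier L. \<forall>y \<in> Y. x \<sqsubseteq>\<^bsub>L\<^esub> y}"
      "Upper M (h ` Y) = {x \<in> h ` carrier L. \<forall>y \<in> Y. h y \<sqsubseteq>\<^bsub>M\<^esub> x}"
      "Lower M (h ` Y) = {x \<in> h ` carrier L. \<forall>y \<in> Y. x \<sqsubseteq>\<^bsub>M\<^esub> h y}"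
    using Y mem by (auto simp: Upper_def Lower_def assms(1))
  have L: "Lower M (h ` Y) = h ` Upper L Y"
    unfolding bounds by (auto simp: Y anti)
  have U: "Upper M (h ` Y) = h ` Lower L Y"
    unfolding bounds by (auto simp: Y anti)
  \<comment> \<open>\<open>h\<close> may identify elements, so \<open>h s\<close> lying in an image
    does not by itself put \<open>s\<close> in the set. The defining inequalities do, because
    \<open>h\<close> reflects the order.\<close>
  have *: "h s \<in> h ` Upper L Y \<longleftrightarrow> s \<in> Upper L Y" "h s \<in> h ` Lower L Y \<longleftrightarrow> s \<in> Lower L Y"
    if "s \<in> carrier L" for s
    unfolding L[symmetric] U[symmetric] using that
    by (auto simp: Upper_def Lower_def Y mem anti)
  have sub: "Upper L Y \<subseteq> carrier L" "Lower L Y \<subseteq> carrier L" by auto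
  show "greatest M (h s) (Lower M (h ` Y)) \<longleftrightarrow> least L s (Upper L Y)" if "s \<in> carrier L"
    unfolding greatest_def least_def L * [OF that] using that sub(1)
    by (auto simp: anti mem subset_iff)
  show "least M (h s) (Upper M (h ` Y)) \<longleftrightarrow> greatest L s (Lower L Y)" if "s \<in> carrier L"
    unfolding greatest_def least_def U * [OF that] using that sub(2)
    by (auto simp: anti mem subset_iff)
qed

text \<open>\<open>m_complete\<close> asks for suprema and infima alike, so a duality that exchanges
  them preserves it.\<close>

lemma m_complete_dual_iff:
  assumes surj: "h ` carrier L = carrier M"
    and anti: "\<And>x y. \<lbrakk>x \<in> carrier L; y \<in> carrier L\<rbrakk> \<Longrightarrow> h x \<sqsubseteq>\<^bsub>M\<^esub> h y \<longleftrightarrow> y \<sqsubseteq>\<^bsub>L\<^esub> x"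
  shows "m_complete m L \<longleftrightarrow> m_complete m M"
proof
  note dual = greatest_Lower_dual_image[OF surj _ anti] least_Upper_dual_image[OF surj _ anti]
  show "m_complete m M" if L: "m_complete m L"
    unfolding m_complete_def
  proof (intro allI impI, elim conjE)
    fix X assume X: "X \<subseteq> carrier M" "|X| \<le>o m"
    \<comment> \<open>One preimage is chosen for each element of \<open>X\<close>, which keeps the
      cardinality at most \<open>m\<close>.\<close>
    define Y where "Y = inv_into (carrier L) h ` X"
    have Y: "Y \<subseteq> carrier L" "h ` Y = X"
      unfolding Y_def using X(1) surj image_inv_into_cancel[OF surj] by (auto intro!: inv_into_into)
    have "|Y| \<le>o m"
      unfolding Y_def using card_of_image X(2) by (rule ordLeq_transitive)
    then obtain s i where si: "least L s (Upper L Y)" "greatest L i (Lower L Y)"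
      using L Y(1) unfolding m_complete_def by blast
    then have "s \<in> carrier L" "i \<in> carrier L"
      using least_closed greatest_closed Upper_closed Lower_closed by metis+
    then show "(\<exists>s. least M s (Upper M X)) \<and> (\<exists>i. greatest M i (Lower M X))"
      using dual[OF Y(1)] si Y(2) by blast
  qed
  show "m_complete m L" if M: "m_complete m M"
    unfolding m_complete_def
  proof (intro allI impI, elim conjE)
    fix Y assume Y: "Y \<subseteq> carrier L" "|Y| \<le>o m"
    have "|h ` Y| \<le>o m" "h ` Y \<subseteq> carrier M"
      using ordLeq_transitive[OF card_of_image Y(2)] image_mono[OF Y(1), of h] surj by simp_all
    then obtain s i where si: "least M s (Upper M (h ` Y))" "greatest M i (Lower M (h ` Y))"
      using M unfolding m_complete_def by blast
    then have "s \<in> carrier M" "i \<in> carrier M"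
      using least_closed greatest_closed Upper_closed Lower_closed by metis+
    then obtain s' i' where "s = h s'" "i = h i'" "s' \<in> carrier L" "i' \<in> carrier L"
      using surj by blast
    then show "(\<exists>s. least L s (Upper L Y)) \<and> (\<exists>i. greatest L i (Lower L Y))"
      using dual[OF Y(1)] si by blast
  qed
qed

section \<open>Complemented elements of a residuated lattice\<close>

text \<open>When \<open>e \<or> f = 1\<close>, the conditions \<open>e \<odot> f = 0\<close> and \<open>e \<and> f = 0\<close> are equivalent.\<close>

definition complementary :: "('a, 'b) residuated_scheme \<Rightarrow> 'a \<Rightarrow> 'a \<Rightarrow> bool" where
  "complementary A e f \<longleftrightarrow> e \<in> carrier A \<and> f \<in> carrier A \<and>
     e \<squnion>\<^bsub>A\<^esub> f = \<top>\<^bsub>A\<^esub> \<and> e \<odot>\<^bsub>A\<^esub> f = \<bottom>\<^bsub>A\<^esub>"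

context residuated_lattice
begin

section \<open>Arithmetic of product, join and residuum\<close>

lemma odot_closed [simp]: "\<lbrakk>a \<in> carrier A; b \<in> carrier A\<rbrakk> \<Longrightarrow> a \<odot> b \<in> carrier A"
  using comm_monoid.axioms(1)[OF odot_comm_monoid] monoid.m_closed by fastforce

lemma odot_comm: "\<lbrakk>a \<in> carrier A; b \<in> carrier A\<rbrakk> \<Longrightarrow> a \<odot> b = b \<odot> a"
  using comm_monoid.m_comm[OF odot_comm_monoid] by simp

lemma odot_assoc:
  "\<lbrakk>a \<in> carrier A; b \<in> carrier A; c \<in> carrier A\<rbrakk> \<Longrightarrow> (a \<odot> b) \<odot> c = a \<odot> (b \<odot> c)"
  using monoid.m_assoc[OF comm_monoid.axioms(1)[OF odot_comm_monoid]] by simp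

lemma odot_top [simp]: "a \<in> carrier A \<Longrightarrow> a \<odot> \<top> = a"
  using monoid.r_one[OF comm_monoid.axioms(1)[OF odot_comm_monoid]] by simp

lemma top_le_iff: "a \<in> carrier A \<Longrightarrow> \<top> \<sqsubseteq> a \<longleftrightarrow> a = \<top>"
  using top_higher le_antisym top_closed by auto

lemma le_bottom_iff: "a \<in> carrier A \<Longrightarrow> a \<sqsubseteq> \<bottom> \<longleftrightarrow> a = \<bottom>"
  using bottom_lower le_antisym bottom_closed by auto

lemma join_le_iff:
  assumes "a \<in> carrier A" "b \<in> carrier A" "c \<in> carrier A"
  shows "a \<squnion> b \<sqsubseteq> c \<longleftrightarrow> a \<sqsubseteq> c \<and> b \<sqsubseteq> c"
  using assms join_le[of a c b] le_trans[OF join_left[of a b]] le_trans[OF join_right[of a b]]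
  by auto

lemma join_assoc:
  "\<lbrakk>x \<in> carrier A; y \<in> carrier A; z \<in> carrier A\<rbrakk> \<Longrightarrow> (x \<squnion> y) \<squnion> z = x \<squnion> (y \<squnion> z)"
  using weak_join_assoc eq_is_equal by simp

lemma odot_le_left: "\<lbrakk>a \<in> carrier A; b \<in> carrier A\<rbrakk> \<Longrightarrow> a \<odot> b \<sqsubseteq> a"
  using odot_mono[of a a b \<top>] top_higher top_closed by simp

lemma odot_le_right: "\<lbrakk>a \<in> carrier A; b \<in> carrier A\<rbrakk> \<Longrightarrow> a \<odot> b \<sqsubseteq> b"
  using odot_le_left[of b a] odot_comm by simp

text \<open>Residuation makes multiplication by \<open>a\<close> a left adjoint: \<open>b\<close>
  and \<open>c\<close> both lie below \<open>a \<rightharpoonup> d\<close>, hence so does their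
  join.\<close>

lemma odot_join_le:
  assumes "a \<in> carrier A" "b \<in> carrier A" "c \<in> carrier A" "d \<in> carrier A"
    and "a \<odot> b \<sqsubseteq> d" "a \<odot> c \<sqsubseteq> d"
  shows "a \<odot> (b \<squnion> c) \<sqsubseteq> d"
proof -
  have "b \<sqsubseteq> a \<rightharpoonup> d" "c \<sqsubseteq> a \<rightharpoonup> d"
    using assms residuation odot_comm by simp_all
  then have "b \<squnion> c \<sqsubseteq> a \<rightharpoonup> d" using assms residuum_closed by (intro join_le) simp_all
  then show ?thesis using assms residuation odot_comm by simp
qed

text \<open>Multiplying by \<open>f \<squnion> g = \<top>\<close> leaves \<open>c\<close> unchanged,
  so an inequality can be tested on the two pieces \<open>c \<odot> f\<close> and
  \<open>c \<odot> g\<close>. This splitting does the work that distributivity would do.\<close>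

lemma le_cover:
  assumes "c \<in> carrier A" "f \<in> carrier A" "g \<in> carrier A" "d \<in> carrier A"
    and "f \<squnion> g = \<top>" "c \<odot> f \<sqsubseteq> d" "c \<odot> g \<sqsubseteq> d"
  shows "c \<sqsubseteq> d"
  using odot_join_le[of c f g d] assms by simp

text \<open>Split \<open>b\<close> along \<open>a \<squnion> c = \<top>\<close>: both pieces lie
  below \<open>(a \<odot> b) \<squnion> c\<close>, hence so do \<open>b\<close> and
  \<open>b \<squnion> c = \<top>\<close>. This is what closes coannihilators under the
  product.\<close>

lemma join_odot_eq_top:
  assumes "a \<in> carrier A" "b \<in> carrier A" "c \<in> carrier A" "a \<squnion> c = \<top>" "b \<squnion> c = \<top>"
  shows "(a \<odot> b) \<squnion> c = \<top>"
proof -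
  let ?d = "(a \<odot> b) \<squnion> c"
  have d: "?d \<in> carrier A" "a \<odot> b \<sqsubseteq> ?d" "c \<sqsubseteq> ?d"
    using assms join_left join_right by simp_all
  have "b \<odot> c \<sqsubseteq> ?d"
    using le_trans[OF odot_le_right d(3)] assms d(1) by simp
  then have "b \<sqsubseteq> ?d"
    using le_cover[of b a c ?d] assms d odot_comm by simp
  then have "b \<squnion> c \<sqsubseteq> ?d" using assms d by (intro join_le)
  then show ?thesis using assms(5) d(1) top_le_iff by simp
qed

section \<open>Complement pairs and the Boolean center\<close>

lemma complementary_sym: "complementary A e f \<Longrightarrow> complementary A f e"
  unfolding complementary_def using join_comm odot_comm by metis

lemma complementary_closed:
  "complementary A e f \<Longrightarrow> e \<in> carrier A" "complementary A e f \<Longrightarrow> f \<in> carrier A"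
  by (simp_all add: complementary_def)

text \<open>Split \<open>e \<sqinter> x\<close> along \<open>e \<squnion> f = \<top>\<close>: the
  piece at \<open>e\<close> is below \<open>x \<odot> e\<close>, and the piece at \<open>f\<close>
  is below \<open>e \<odot> f = \<bottom>\<close>.\<close>

lemma odot_eq_meet:
  assumes "complementary A e f" "x \<in> carrier A"
  shows "e \<odot> x = e \<sqinter> x"
proof -
  have ef: "e \<in> carrier A" "f \<in> carrier A" "e \<squnion> f = \<top>" "e \<odot> f = \<bottom>"
    using assms(1) by (auto simp: complementary_def)
  let ?m = "e \<sqinter> x"
  have m: "?m \<in> carrier A" "?m \<sqsubseteq> e" "?m \<sqsubseteq> x"
    using ef assms(2) meet_left meet_right by simp_all
  have "?m \<odot> e \<sqsubseteq> x \<odot> e" using m ef assms(2) by (intro odot_mono) simp_all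
  moreover have "?m \<odot> f \<sqsubseteq> e \<odot> f" using m ef assms(2) by (intro odot_mono) simp_all
  ultimately have "?m \<sqsubseteq> e \<odot> x"
    using le_cover[of ?m e f "e \<odot> x"] ef assms(2) m(1) odot_comm[of x e] le_bottom_iff bottom_lower
    by simp
  moreover have "e \<odot> x \<sqsubseteq> ?m"
    using ef assms(2) odot_le_left odot_le_right by (intro meet_le) simp_all
  ultimately show ?thesis using le_antisym ef assms(2) by simp
qed

lemma complemented_iff: "e \<in> complemented A \<longleftrightarrow> (\<exists>f. complementary A e f)"
proof
  assume "e \<in> complemented A"
  then obtain f where ef: "e \<in> carrier A" "f \<in> carrier A" "e \<squnion> f = \<top>" "e \<sqinter> f = \<bottom>"
    by (auto simp: complemented_def)
  then have "e \<odot> f \<sqsubseteq> \<bottom>"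
    using meet_le[OF odot_le_left odot_le_right, of e f] by simp
  then show "\<exists>f. complementary A e f" using ef le_bottom_iff by (auto simp: complementary_def)
next
  assume "\<exists>f. complementary A e f"
  then obtain f where f: "complementary A e f" by blast
  then show "e \<in> complemented A"
    using odot_eq_meet[OF f, of f] by (auto simp: complementary_def complemented_def)
qed

lemma complementary_complemented:
  assumes "complementary A e f"
  shows "e \<in> complemented A" "f \<in> complemented A"
  using assms complementary_sym[OF assms] unfolding complemented_iff by blast+

text \<open>For the forward direction split \<open>e\<close> along
  \<open>x \<squnion> f = \<top>\<close>; the piece \<open>e \<odot> f\<close> vanishes. The
  equivalence translates between joins equal to \<open>\<top>\<close>, which define coannihilators,
  and the order, which describes principal filters.\<close>

lemma complementary_le_iff:
  assumes "complementary A e f" "x \<in> carrier A"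
  shows "x \<squnion> f = \<top> \<longleftrightarrow> e \<sqsubseteq> x"
proof -
  have ef: "e \<in> carrier A" "f \<in> carrier A" "e \<squnion> f = \<top>" "e \<odot> f = \<bottom>"
    using assms(1) by (auto simp: complementary_def)
  show ?thesis
  proof
    assume "x \<squnion> f = \<top>"
    then show "e \<sqsubseteq> x"
      using le_cover[of e x f x] ef assms(2) odot_le_right bottom_lower by simp
  next
    assume "e \<sqsubseteq> x"
    then have "e \<sqsubseteq> x \<squnion> f" using le_trans[OF _ join_left] ef assms(2) by simp
    moreover have "f \<sqsubseteq> x \<squnion> f" using join_right ef assms(2) by simp
    ultimately have "e \<squnion> f \<sqsubseteq> x \<squnion> f" using ef assms(2) by (intro join_le) simp_all
    then show "x \<squnion> f = \<top>" using ef assms(2) top_le_iff by simp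
  qed
qed

text \<open>Both inequalities express \<open>e' \<squnion> f = \<top>\<close>.\<close>

lemma complementary_antimono:
  assumes "complementary A e f" "complementary A e' f'"
  shows "e \<sqsubseteq> e' \<longleftrightarrow> f' \<sqsubseteq> f"
  using complementary_le_iff[OF assms(1)] complementary_le_iff[OF complementary_sym[OF assms(2)]]
    complementary_closed[OF assms(1)] complementary_closed[OF assms(2)] join_comm by metis

text \<open>De Morgan for complement pairs. By symmetry of \<open>complementary\<close> it closes
  the complemented elements under product and join at once.\<close>

lemma complementary_odot_join:
  assumes "complementary A e f" "complementary A e' f'"
  shows "complementary A (e \<odot> e') (f \<squnion> f')"
proof -
  note cl = complementary_closed[OF assms(1)] complementary_closed[OF assms(2)]
  have le: "e \<odot> e' \<sqsubseteq> e" "e \<odot> e' \<sqsubseteq> e'" using cl odot_le_left odot_le_right by simp_all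
  have "(e \<odot> e') \<odot> f \<sqsubseteq> e \<odot> f" "(e \<odot> e') \<odot> f' \<sqsubseteq> e' \<odot> f'"
    using le cl by (auto intro!: odot_mono)
  then have "(e \<odot> e') \<odot> (f \<squnion> f') \<sqsubseteq> \<bottom>"
    using assms cl by (intro odot_join_le) (simp_all add: complementary_def)
  moreover have "e \<squnion> (f \<squnion> f') = \<top>" "e' \<squnion> (f \<squnion> f') = \<top>"
  proof -
    have *: "x \<squnion> y = \<top>" if "x \<squnion> z = \<top>" "z \<sqsubseteq> y" "x \<in> carrier A" "y \<in> carrier A" "z \<in> carrier A" for x y z
    proof -
      have "z \<sqsubseteq> x \<squnion> y" using le_trans[OF that(2) join_right] that by simp
      then have "x \<squnion> z \<sqsubseteq> x \<squnion> y" using that join_left by (intro join_le) simp_all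
      then show ?thesis using that top_le_iff by simp
    qed
    show "e \<squnion> (f \<squnion> f') = \<top>"
      using *[of e f "f \<squnion> f'"] assms(1) cl join_left by (simp add: complementary_def)
    show "e' \<squnion> (f \<squnion> f') = \<top>"
      using *[of e' f' "f \<squnion> f'"] assms(2) cl join_right by (simp add: complementary_def)
  qed
  ultimately show ?thesis
    using cl join_odot_eq_top le_bottom_iff by (simp add: complementary_def)
qed

lemma complementary_top_bottom: "complementary A \<top> \<bottom>"
  unfolding complementary_def using top_closed bottom_closed odot_comm top_le_iff join_left[of \<top> \<bottom>]
  by simp

lemma complemented_odot_meet:
  "\<lbrakk>e \<in> complemented A; x \<in> carrier A\<rbrakk> \<Longrightarrow> e \<sqinter> x = e \<odot> x"
  using complemented_iff odot_eq_meet by metis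

lemma complemented_closed: "e \<in> complemented A \<Longrightarrow> e \<in> carrier A"
  by (simp add: complemented_def)

lemma
  assumes "x \<in> complemented A" "y \<in> complemented A"
  shows complemented_join: "x \<squnion> y \<in> complemented A"
    and complemented_odot: "x \<odot> y \<in> complemented A"
    and complemented_meet: "x \<sqinter> y \<in> complemented A"
  using assms complementary_odot_join complementary_sym complemented_iff
    complemented_odot_meet complemented_closed by metis+

lemma top_complemented: "\<top> \<in> complemented A" and bottom_complemented: "\<bottom> \<in> complemented A"
  using complementary_top_bottom complementary_sym complemented_iff by blast+

lemma sublattice_complemented: "sublattice (complemented A) A"
  unfolding sublattice_def using complemented_closed complemented_join complemented_meet by blast

text \<open>Meeting with \<open>e\<close> is multiplying by \<open>e\<close>, and products preserve
  joins.\<close>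

lemma meet_join_distrib_complemented:
  assumes "e \<in> complemented A" "x \<in> carrier A" "y \<in> carrier A"
  shows "e \<sqinter> (x \<squnion> y) = (e \<sqinter> x) \<squnion> (e \<sqinter> y)"
proof (rule le_antisym)
  note e = complemented_closed[OF assms(1)]
  show "e \<sqinter> (x \<squnion> y) \<sqsubseteq> (e \<sqinter> x) \<squnion> (e \<sqinter> y)"
    using assms e join_left[of "e \<odot> x" "e \<odot> y"] join_right[of "e \<odot> x" "e \<odot> y"]
    by (simp add: complemented_odot_meet odot_join_le)
  show "(e \<sqinter> x) \<squnion> (e \<sqinter> y) \<sqsubseteq> e \<sqinter> (x \<squnion> y)"
    using assms e join_left[of x y] join_right[of x y]
    by (simp add: complemented_odot_meet join_le odot_mono)
qed (use assms complemented_closed[OF assms(1)] in simp_all)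

text \<open>Split the right-hand side along \<open>e\<close> and its complement \<open>f\<close>.
  The piece at \<open>e\<close> is below \<open>e\<close>; the piece at \<open>f\<close> is below
  both \<open>x\<close> and \<open>y\<close>, since
  \<open>f \<odot> (e \<squnion> z) \<sqsubseteq> z\<close>. This dual law is the one that becomes
  distributivity of filters.\<close>

lemma join_meet_distrib_complemented:
  assumes "e \<in> complemented A" "x \<in> carrier A" "y \<in> carrier A"
  shows "e \<squnion> (x \<sqinter> y) = (e \<squnion> x) \<sqinter> (e \<squnion> y)"
proof (rule le_antisym)
  obtain f where f: "complementary A e f" using assms(1) complemented_iff by blast
  then have ef: "e \<in> carrier A" "f \<in> carrier A" "e \<squnion> f = \<top>" "f \<odot> e = \<bottom>"
    using odot_comm by (auto simp: complementary_def)
  let ?t = "(e \<squnion> x) \<sqinter> (e \<squnion> y)"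
  have t: "?t \<in> carrier A" "?t \<sqsubseteq> e \<squnion> x" "?t \<sqsubseteq> e \<squnion> y"
    using assms ef meet_left meet_right by simp_all
  have *: "?t \<odot> f \<sqsubseteq> z" if z: "z \<in> carrier A" "?t \<sqsubseteq> e \<squnion> z" for z
  proof -
    have "f \<odot> (e \<squnion> z) \<sqsubseteq> z"
      using odot_join_le[of f e z z] odot_le_right[of f z] ef z(1) bottom_lower by simp
    moreover have "?t \<odot> f \<sqsubseteq> f \<odot> (e \<squnion> z)"
      using odot_mono[of ?t "e \<squnion> z" f f] odot_comm[of f "e \<squnion> z"] z t(1) ef by simp
    ultimately show ?thesis
      using le_trans[of "?t \<odot> f" "f \<odot> (e \<squnion> z)" z] z(1) t(1) ef by simp
  qed
  have "?t \<odot> f \<sqsubseteq> x \<sqinter> y"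
    using *[OF assms(2) t(2)] *[OF assms(3) t(3)] assms t(1) ef by (simp add: meet_le)
  then have "?t \<odot> f \<sqsubseteq> e \<squnion> (x \<sqinter> y)"
    using le_trans[OF _ join_right[of e "x \<sqinter> y"]] assms t(1) ef by simp
  moreover have "?t \<odot> e \<sqsubseteq> e \<squnion> (x \<sqinter> y)"
    using le_trans[OF odot_le_right[of ?t e] join_left[of e "x \<sqinter> y"]] assms t(1) ef by simp
  ultimately show "?t \<sqsubseteq> e \<squnion> (x \<sqinter> y)"
    using le_cover[of ?t e f] assms t(1) ef by simp
  show "e \<squnion> (x \<sqinter> y) \<sqsubseteq> ?t"
    using assms(2,3) ef join_left[of e x] join_left[of e y] meet_left[of x y] meet_right[of x y]
      le_trans[OF meet_left[of x y] join_right[of e x]]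
      le_trans[OF meet_right[of x y] join_right[of e y]]
    by (simp add: meet_le join_le_iff)
qed (use assms complemented_closed[OF assms(1)] in simp_all)

lemma boolean_lattice_center: "boolean_lattice (boolean_center A)"
proof (rule boolean_lattice_sublatticeI)
  show "\<exists>f \<in> complemented A. e \<squnion> f = \<top> \<and> e \<sqinter> f = \<bottom>" if "e \<in> complemented A" for e
  proof -
    from that obtain f where f: "complementary A e f" using complemented_iff by blast
    then show ?thesis
      using complementary_complemented(2)[OF f] odot_eq_meet[OF f]
      by (auto simp: complementary_def)
  qed
qed (simp_all add: sublattice_complemented top_complemented bottom_complemented
    meet_join_distrib_complemented complemented_closed)

section \<open>Filters and coannihilators\<close>

text \<open>Products with \<open>e\<close> are meets, so \<open>e\<close> is idempotent and its
  up-set is already closed under the product.\<close>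

lemma filter_gen_complemented:
  assumes "e \<in> complemented A"
  shows "filter_gen A {e} = {x \<in> carrier A. e \<sqsubseteq> x}"
  unfolding filter_gen_def
proof (rule hull_unique)
  note e = complemented_closed[OF assms]
  show "{e} \<subseteq> {x \<in> carrier A. e \<sqsubseteq> x}" using e by simp
  have idem: "e \<odot> e = e"
    using complemented_odot_meet[OF assms e] meet_left[of e e] meet_le[of e e e] e
      le_antisym[of "e \<sqinter> e" e] by simp
  have "e \<sqsubseteq> x \<odot> y" if "x \<in> carrier A" "y \<in> carrier A" "e \<sqsubseteq> x" "e \<sqsubseteq> y" for x y
    using odot_mono[of e x e y] that e idem by simp
  then show "rl_filter A {x \<in> carrier A. e \<sqsubseteq> x}"
    unfolding rl_filter_def using e le_trans by auto
  show "{x \<in> carrier A. e \<sqsubseteq> x} \<subseteq> F" if "{e} \<subseteq> F" "rl_filter A F" for F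
    using that unfolding rl_filter_def by blast
qed

lemma filter_gen_bottom: "filter_gen A {\<bottom>} = carrier A"
  by (auto simp: filter_gen_complemented bottom_complemented bottom_lower)

lemma filter_gen_top: "filter_gen A {\<top>} = {\<top>}"
  by (auto simp: filter_gen_complemented top_complemented top_le_iff)

text \<open>Commutativity regroups a product of two elements \<open>f \<odot> g\<close> as one of
  the same shape, so the right-hand side is a filter. It contains \<open>F\<close> and
  \<open>G\<close> because \<open>\<top>\<close> lies in both.\<close>

lemma filter_join_eq:
  assumes "rl_filter A F" "rl_filter A G"
  shows "filter_join A F G = {x \<in> carrier A. \<exists>f \<in> F. \<exists>g \<in> G. f \<odot> g \<sqsubseteq> x}"
  unfolding filter_join_def filter_gen_def
proof (rule hull_unique)
  let ?H = "{x \<in> carrier A. \<exists>f \<in> F. \<exists>g \<in> G. f \<odot> g \<sqsubseteq> x}"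
  have F: "f \<in> carrier A" if "f \<in> F" for f using that assms(1) by (auto simp: rl_filter_def)
  have G: "g \<in> carrier A" if "g \<in> G" for g using that assms(2) by (auto simp: rl_filter_def)
  note top = top_in_filter[OF assms(1)] top_in_filter[OF assms(2)]
  show sub: "F \<union> G \<subseteq> ?H"
    using F G top odot_le_left odot_le_right by blast
  show "rl_filter A ?H"
    unfolding rl_filter_def
  proof (intro conjI ballI impI)
    fix x y assume "x \<in> ?H" "y \<in> ?H"
    then obtain f g f' g' where *: "f \<in> F" "g \<in> G" "f' \<in> F" "g' \<in> G"
      "f \<odot> g \<sqsubseteq> x" "f' \<odot> g' \<sqsubseteq> y" "x \<in> carrier A" "y \<in> carrier A" by blast
    note c = *(7,8) F[OF *(1)] F[OF *(3)] G[OF *(2)] G[OF *(4)]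
    have "(f \<odot> f') \<odot> (g \<odot> g') = (f \<odot> g) \<odot> (f' \<odot> g')"
      using c odot_assoc odot_comm odot_closed by metis
    moreover have "(f \<odot> g) \<odot> (f' \<odot> g') \<sqsubseteq> x \<odot> y" using * c by (intro odot_mono) simp_all
    moreover have "f \<odot> f' \<in> F" "g \<odot> g' \<in> G" using * assms by (auto simp: rl_filter_def)
    ultimately have "\<exists>f \<in> F. \<exists>g \<in> G. f \<odot> g \<sqsubseteq> x \<odot> y" by metis
    then show "x \<odot> y \<in> ?H" using c by simp
  next
    fix x y assume "x \<in> ?H" and y: "y \<in> carrier A" "x \<sqsubseteq> y"
    then obtain f g where *: "f \<in> F" "g \<in> G" "f \<odot> g \<sqsubseteq> x" "x \<in> carrier A" by blast
    then have "f \<odot> g \<sqsubseteq> y" using le_trans[OF *(3) y(2)] y F G by simp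
    then show "y \<in> ?H" using * y by blast
  qed (use sub top in auto)
  show "?H \<subseteq> K" if "F \<union> G \<subseteq> K" "rl_filter A K" for K
    using that unfolding rl_filter_def by blast
qed

text \<open>A filter is all of \<open>A\<close> exactly when it contains
  \<open>\<bottom>\<close>.\<close>

lemma filter_join_eq_carrier_iff:
  assumes "rl_filter A F" "rl_filter A G"
  shows "filter_join A F G = carrier A \<longleftrightarrow> (\<exists>f \<in> F. \<exists>g \<in> G. f \<odot> g = \<bottom>)"
proof -
  have cl: "f \<odot> g \<in> carrier A" if "f \<in> F" "g \<in> G" for f g
    using that assms by (auto simp: rl_filter_def intro!: odot_closed)
  show ?thesis
  proof
    assume "filter_join A F G = carrier A"
    then have "\<bottom> \<in> filter_join A F G" using bottom_closed by simp
    then show "\<exists>f \<in> F. \<exists>g \<in> G. f \<odot> g = \<bottom>"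
      unfolding filter_join_eq[OF assms] using le_bottom_iff cl by blast
  next
    assume "\<exists>f \<in> F. \<exists>g \<in> G. f \<odot> g = \<bottom>"
    then have "\<exists>f \<in> F. \<exists>g \<in> G. f \<odot> g \<sqsubseteq> x" if "x \<in> carrier A" for x
      using bottom_lower[OF that] by metis
    then show "filter_join A F G = carrier A"
      unfolding filter_join_eq[OF assms] by blast
  qed
qed

text \<open>The join supplies \<open>f \<odot> g = \<bottom>\<close>. Joins of elements of
  \<open>F\<close> with elements of \<open>G\<close> lie in \<open>F \<inter> G\<close>, so they
  equal \<open>\<top>\<close>; through \<open>complementary_le_iff\<close> this puts
  \<open>f\<close> below all of \<open>F\<close> and \<open>g\<close> below all of
  \<open>G\<close>.\<close>

lemma complementary_filters:
  assumes F: "rl_filter A F" and G: "rl_filter A G"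
    and join: "filter_join A F G = carrier A" and meet: "F \<inter> G = {\<top>}"
  obtains e f where "complementary A e f" "F = filter_gen A {e}" "G = filter_gen A {f}"
proof -
  obtain f g where fg: "f \<in> F" "g \<in> G" "f \<odot> g = \<bottom>"
    using filter_join_eq_carrier_iff[OF F G] join by blast
  have cl: "x \<in> carrier A" if "x \<in> F \<union> G" for x using that F G by (auto simp: rl_filter_def)
  have join_top: "x \<squnion> y = \<top>" if "x \<in> F" "y \<in> G" for x y
  proof -
    have "x \<squnion> y \<in> carrier A" "x \<sqsubseteq> x \<squnion> y" "y \<sqsubseteq> x \<squnion> y"
      using that cl join_left join_right by auto
    then have "x \<squnion> y \<in> F \<inter> G" using that F G by (auto simp: rl_filter_def)
    then show ?thesis using meet by simp
  qed
  have c: "complementary A f g" using fg cl join_top by (simp add: complementary_def)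
  have f: "f \<sqsubseteq> x" if "x \<in> F" for x
    using complementary_le_iff[OF c, of x] join_top[OF that fg(2)] cl that by simp
  have g: "g \<sqsubseteq> x" if "x \<in> G" for x
    using complementary_le_iff[OF complementary_sym[OF c], of x] join_top[OF fg(1) that]
      join_comm[of A x f] cl that by simp
  have "F = filter_gen A {f}"
    unfolding filter_gen_complemented[OF complementary_complemented(1)[OF c]]
    using F fg(1) f unfolding rl_filter_def by blast
  moreover have "G = filter_gen A {g}"
    unfolding filter_gen_complemented[OF complementary_complemented(2)[OF c]]
    using G fg(2) g unfolding rl_filter_def by blast
  ultimately show ?thesis using c that by blast
qed

section \<open>Coannihilators and principal filters of complemented elements\<close>

lemma coann_filter:
  assumes "X \<subseteq> carrier A"
  shows "rl_filter A (coann A X)"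
  unfolding rl_filter_def
proof (intro conjI ballI impI)
  have "\<top> \<squnion> x = \<top>" if "x \<in> X" for x
    using that assms join_left[of \<top> x] top_le_iff by auto
  then show "coann A X \<noteq> {}" using top_closed by (auto simp: coann_def)
  fix a b assume "a \<in> coann A X" "b \<in> coann A X"
  then show "a \<odot> b \<in> coann A X"
    using assms join_odot_eq_top by (auto simp: coann_def)
next
  fix a b assume a: "a \<in> coann A X" and b: "b \<in> carrier A" "a \<sqsubseteq> b"
  have "b \<squnion> x = \<top>" if "x \<in> X" for x
  proof -
    have x: "x \<in> carrier A" "a \<in> carrier A" "a \<squnion> x = \<top>" using a that assms by (auto simp: coann_def)
    have "a \<sqsubseteq> b \<squnion> x" using le_trans[OF b(2) join_left] x b(1) by simp
    then have "a \<squnion> x \<sqsubseteq> b \<squnion> x" using x b(1) join_right by (intro join_le) simp_all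
    then show ?thesis using x b(1) top_le_iff by simp
  qed
  then show "b \<in> coann A X" using b(1) by (simp add: coann_def)
qed (simp add: coann_def)

lemma coann_subset: "coann A X \<subseteq> carrier A"
  by (auto simp: coann_def)

lemma coann_antimono: "X \<subseteq> Y \<Longrightarrow> coann A Y \<subseteq> coann A X"
  by (auto simp: coann_def)

lemma subset_coann_coann: "X \<subseteq> carrier A \<Longrightarrow> X \<subseteq> coann A (coann A X)"
  by (auto simp: coann_def join_comm[of A _ "_ :: 'a"])

text \<open>The usual collapse in an antitone Galois connection of \<open>coann A\<close> with
  itself.\<close>

lemma coann_coann_coann: "X \<subseteq> carrier A \<Longrightarrow> coann A (coann A (coann A X)) = coann A X"
  by (intro subset_antisym coann_antimono subset_coann_coann coann_subset)

text \<open>The double coannihilator of \<open>X\<close> is a filter containing \<open>X\<close>,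
  hence contains the generated filter; one more coannihilator gives the nontrivial
  inclusion.\<close>

lemma coann_filter_gen:
  assumes "X \<subseteq> carrier A"
  shows "coann A (filter_gen A X) = coann A X"
proof
  have "X \<subseteq> filter_gen A X" unfolding filter_gen_def by (rule hull_subset)
  then show "coann A (filter_gen A X) \<subseteq> coann A X" by (rule coann_antimono)
  have "filter_gen A X \<subseteq> coann A (coann A X)"
    unfolding filter_gen_def using assms
    by (intro hull_minimal subset_coann_coann coann_filter coann_subset)
  from coann_antimono[OF this] show "coann A X \<subseteq> coann A (filter_gen A X)"
    using coann_coann_coann[OF assms] by simp
qed

text \<open>A common element satisfies \<open>x \<squnion> x = \<top>\<close>.\<close>

lemma coann_Int_coann_coann:
  assumes "X \<subseteq> carrier A"
  shows "coann A X \<inter> coann A (coann A X) = {\<top>}"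
proof -
  have "x = \<top>" if "x \<in> coann A X" "x \<in> coann A (coann A X)" for x
  proof -
    have x: "x \<in> carrier A" "x \<squnion> x = \<top>" using that by (auto simp: coann_def)
    then have "x \<squnion> x \<sqsubseteq> x" by (intro join_le) simp_all
    then show ?thesis using x top_le_iff by simp
  qed
  then show ?thesis
    using top_in_filter coann_filter[OF assms] coann_filter[OF coann_subset] by blast
qed

lemma coann_top: "coann A {\<top>} = carrier A"
  using join_right[OF _ top_closed] by (auto simp: coann_def top_le_iff)

lemma coann_carrier: "coann A (carrier A) = {\<top>}"
  using coann_Int_coann_coann[of "{\<top>}"] coann_subset[of "carrier A"]
  by (simp add: coann_top Int_absorb1)

lemma coann_complementary:
  assumes "complementary A e f"
  shows "coann A {f} = filter_gen A {e}"
  using complementary_le_iff[OF assms] complementary_complemented[OF assms]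
  by (auto simp: coann_def filter_gen_complemented)

lemma coann_filter_gen_complementary:
  assumes "complementary A e f"
  shows "coann A (filter_gen A {e}) = filter_gen A {f}"
  using coann_filter_gen[of "{e}"] coann_complementary[OF complementary_sym[OF assms]]
    complementary_closed[OF assms] by simp

lemma filter_gen_subset_iff:
  assumes "e \<in> complemented A" "f \<in> complemented A"
  shows "filter_gen A {e} \<subseteq> filter_gen A {f} \<longleftrightarrow> f \<sqsubseteq> e"
  using complemented_closed[OF assms(1)] complemented_closed[OF assms(2)] le_trans[of f e]
  by (auto simp: filter_gen_complemented assms)

text \<open>Passing from generators to filters reverses the order. For the join, the elements above
  some \<open>a \<odot> b\<close> with \<open>a\<close> above \<open>e\<close> and \<open>b\<close>
  above \<open>f\<close> are those above \<open>e \<odot> f\<close>, which is the meet.\<close>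

lemma
  assumes "e \<in> complemented A" "f \<in> complemented A"
  shows filter_gen_Int: "filter_gen A {e} \<inter> filter_gen A {f} = filter_gen A {e \<squnion> f}"
    and filter_join_gen: "filter_join A (filter_gen A {e}) (filter_gen A {f}) = filter_gen A {e \<sqinter> f}"
proof -
  note cl = complemented_closed[OF assms(1)] complemented_closed[OF assms(2)]
  show "filter_gen A {e} \<inter> filter_gen A {f} = filter_gen A {e \<squnion> f}"
    unfolding filter_gen_complemented[OF assms(1)] filter_gen_complemented[OF assms(2)]
      filter_gen_complemented[OF complemented_join[OF assms]]
    by (auto simp: join_le_iff cl)
  have fil: "rl_filter A (filter_gen A {e})" "rl_filter A (filter_gen A {f})"
    using cl by (simp_all add: rl_filter_gen)
  have "(\<exists>a \<in> filter_gen A {e}. \<exists>b \<in> filter_gen A {f}. a \<odot> b \<sqsubseteq> x) \<longleftrightarrow> e \<odot> f \<sqsubseteq> x"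
    if "x \<in> carrier A" for x
  proof
    assume "\<exists>a \<in> filter_gen A {e}. \<exists>b \<in> filter_gen A {f}. a \<odot> b \<sqsubseteq> x"
    then obtain a b where ab: "a \<in> carrier A" "e \<sqsubseteq> a" "b \<in> carrier A" "f \<sqsubseteq> b" "a \<odot> b \<sqsubseteq> x"
      by (auto simp: filter_gen_complemented assms)
    then have "e \<odot> f \<sqsubseteq> a \<odot> b" using cl by (intro odot_mono)
    then show "e \<odot> f \<sqsubseteq> x" using le_trans[OF _ ab(5)] ab cl that by simp
  next
    assume "e \<odot> f \<sqsubseteq> x"
    then show "\<exists>a \<in> filter_gen A {e}. \<exists>b \<in> filter_gen A {f}. a \<odot> b \<sqsubseteq> x"
      using cl by (intro bexI[of _ e] bexI[of _ f]) (auto simp: filter_gen_complemented assms)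
  qed
  then show "filter_join A (filter_gen A {e}) (filter_gen A {f}) = filter_gen A {e \<sqinter> f}"
    unfolding filter_join_eq[OF fil] complemented_odot_meet[OF assms(1) cl(2)]
      filter_gen_complemented[OF complemented_odot[OF assms]] by blast
qed

section \<open>The equivalences\<close>

text \<open>This is (I) against (V) for one fixed \<open>X\<close>. Forward, the two filters meet in
  \<open>{\<top>}\<close>, so \<open>complementary_filters\<close> applies; backward, they are
  generated by complementary elements, whose meet \<open>\<bottom>\<close> generates
  everything.\<close>

lemma filter_join_coann_iff:
  assumes "X \<subseteq> carrier A"
  shows "filter_join A (coann A X) (coann A (coann A X)) = carrier A \<longleftrightarrow>
    (\<exists>e \<in> complemented A. coann A X = filter_gen A {e})"
proof
  assume "filter_join A (coann A X) (coann A (coann A X)) = carrier A"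
  then obtain e f where "complementary A e f" "coann A X = filter_gen A {e}"
    using complementary_filters[OF coann_filter[OF assms] coann_filter[OF coann_subset]]
      coann_Int_coann_coann[OF assms] by metis
  then show "\<exists>e \<in> complemented A. coann A X = filter_gen A {e}"
    using complementary_complemented(1) by blast
next
  assume "\<exists>e \<in> complemented A. coann A X = filter_gen A {e}"
  then obtain e f where ef: "complementary A e f" "coann A X = filter_gen A {e}"
    using complemented_iff by blast
  have "e \<sqinter> f = \<bottom>"
    using ef(1) odot_eq_meet[OF ef(1), of f] by (simp add: complementary_def)
  then show "filter_join A (coann A X) (coann A (coann A X)) = carrier A"
    using complementary_complemented[OF ef(1)]
    by (simp add: ef(2) coann_filter_gen_complementary[OF ef(1)] filter_join_gen filter_gen_bottom)
qed

text \<open>\<open>a\<close> and the complement \<open>e'\<close> of \<open>e\<close> have the same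
  coannihilator, as do \<open>b\<close> and \<open>f'\<close>. In a join equal to
  \<open>\<top>\<close> they can therefore be exchanged one at a time, after which De Morgan
  applies.\<close>

lemma coann_join:
  assumes "a \<in> carrier A" "b \<in> carrier A" "e \<in> complemented A" "f \<in> complemented A"
    and ea: "coann A {a} = filter_gen A {e}" and fb: "coann A {b} = filter_gen A {f}"
  shows "coann A {a \<squnion> b} = filter_join A (coann A {a}) (coann A {b})"
proof -
  obtain e' f' where c: "complementary A e e'" "complementary A f f'"
    using assms complemented_iff by blast
  note cl = assms(1,2) complementary_closed[OF c(1)] complementary_closed[OF c(2)]
  have a: "x \<squnion> a = \<top> \<longleftrightarrow> e \<sqsubseteq> x" and b: "x \<squnion> b = \<top> \<longleftrightarrow> f \<sqsubseteq> x" if "x \<in> carrier A" for x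
    using that ea fb by (auto simp: coann_def filter_gen_complemented assms(3,4))
  have "x \<squnion> (a \<squnion> b) = \<top> \<longleftrightarrow> e \<odot> f \<sqsubseteq> x" if x: "x \<in> carrier A" for x
  proof -
    have "x \<squnion> (a \<squnion> b) = (x \<squnion> b) \<squnion> a"
      using x cl join_assoc join_comm[of A a b] by simp
    then have "x \<squnion> (a \<squnion> b) = \<top> \<longleftrightarrow> (x \<squnion> b) \<squnion> e' = \<top>"
      using a[of "x \<squnion> b"] complementary_le_iff[OF c(1), of "x \<squnion> b"] x cl by simp
    also have "(x \<squnion> b) \<squnion> e' = (x \<squnion> e') \<squnion> b"
      using x cl join_assoc join_comm[of A b e'] by simp
    also have "(x \<squnion> e') \<squnion> b = \<top> \<longleftrightarrow> (x \<squnion> e') \<squnion> f' = \<top>"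
      using b[of "x \<squnion> e'"] complementary_le_iff[OF c(2), of "x \<squnion> e'"] x cl by simp
    also have "\<dots> \<longleftrightarrow> e \<odot> f \<sqsubseteq> x"
      using complementary_le_iff[OF complementary_odot_join[OF c] x] x cl join_assoc by simp
    finally show ?thesis .
  qed
  then show ?thesis
    unfolding ea fb filter_join_gen[OF assms(3,4)] complemented_odot_meet[OF assms(3) cl(5)]
      filter_gen_complemented[OF complemented_odot[OF assms(3,4)]]
    by (auto simp: coann_def)
qed

text \<open>Under (IV), \<open>x\<close> comes from \<open>X\<close> and \<open>y\<close> from the
  singleton \<open>{x}\<close>. The assumptions make \<open>y\<close> a member of
  \<open>coann A {x}\<close>, so \<open>y \<squnion> x = \<top>\<close>, while
  \<open>coann A X = coann A {y}\<close>.\<close>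

lemma filter_join_coann_if_coann_coann:
  assumes join: "\<And>a b. \<lbrakk>a \<in> carrier A; b \<in> carrier A\<rbrakk> \<Longrightarrow>
      coann A {a \<squnion> b} = filter_join A (coann A {a}) (coann A {b})"
    and X: "X \<subseteq> carrier A" and x: "x \<in> carrier A" "coann A (coann A X) = coann A {x}"
    and y: "y \<in> carrier A" "coann A (coann A {x}) = coann A {y}"
  shows "filter_join A (coann A X) (coann A (coann A X)) = carrier A"
proof -
  have "coann A {x} = coann A (coann A {y})"
    using coann_coann_coann[of "{x}"] x(1) y(2) by simp
  then have "y \<in> coann A {x}" using subset_coann_coann[of "{y}"] y(1) by auto
  then have "coann A {y \<squnion> x} = carrier A" by (simp add: coann_def[of _ "{x}"] coann_top)
  moreover have "coann A X = coann A {y}"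
    using coann_coann_coann[OF X] x(2) y(2) by simp
  ultimately show ?thesis using join[OF y(1) x(1)] x(2) by simp
qed

section \<open>Completeness of the center and principal coannihilators\<close>

text \<open>\<open>x \<sqsubseteq> a\<close> means \<open>a \<squnion> k x = \<top>\<close>. Upper
  bounds thus form a coannihilator, which is how (I) produces suprema.\<close>

lemma coann_image_complements:
  assumes "X \<subseteq> complemented A" "\<And>x. x \<in> X \<Longrightarrow> complementary A x (k x)"
  shows "coann A (k ` X) = {a \<in> carrier A. \<forall>x \<in> X. x \<sqsubseteq> a}"
  using complementary_le_iff[OF assms(2)] by (auto simp: coann_def)

text \<open>The supremum of \<open>X\<close> generates the coannihilator of the complements of its
  elements; the infimum is the complement of the generator of \<open>coann A X\<close>.\<close>

lemma m_complete_center: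
  assumes I: "\<And>X. \<lbrakk>X \<subseteq> carrier A; X \<noteq> {}; |X| \<le>o m\<rbrakk> \<Longrightarrow>
      \<exists>e \<in> complemented A. coann A X = filter_gen A {e}"
  shows "m_complete m (boolean_center A)"
  unfolding m_complete_def
proof (intro allI impI, elim conjE)
  let ?B = "boolean_center A"
  fix X assume "X \<subseteq> carrier ?B" and Xm: "|X| \<le>o m"
  then have X: "X \<subseteq> complemented A" by simp
  show "(\<exists>s. least ?B s (Upper ?B X)) \<and> (\<exists>i. greatest ?B i (Lower ?B X))"
  \<comment> \<open>The assumption covers only non-empty sets, whereas completeness includes the
    empty one, with supremum \<open>\<bottom>\<close> and infimum \<open>\<top>\<close>.\<close>
  proof (cases "X = {}")
    case True
    have "least ?B \<bottom> (Upper ?B X)" "greatest ?B \<top> (Lower ?B X)"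
      using True bottom_complemented top_complemented complemented_closed
      by (auto simp: least_def greatest_def bottom_lower top_higher)
    then show ?thesis by blast
  next
    case False
    obtain k where k: "complementary A e (k e)" if "e \<in> complemented A" for e
      using complemented_iff by metis
    have kB: "k e \<in> complemented A" if "e \<in> complemented A" for e
      using complementary_complemented(2)[OF k[OF that]] .
    have "k ` X \<subseteq> carrier A" "k ` X \<noteq> {}" "|k ` X| \<le>o m"
      using X kB complemented_closed False ordLeq_transitive[OF card_of_image Xm] by auto
    then obtain s where s: "s \<in> complemented A" "coann A (k ` X) = filter_gen A {s}"
      using I by blast
    have s_le: "s \<sqsubseteq> a \<longleftrightarrow> (\<forall>x \<in> X. x \<sqsubseteq> a)" if "a \<in> carrier A" for a
      using s that k X coann_image_complements[OF X, of k]
      by (auto simp: filter_gen_complemented subset_iff)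
    have "X \<subseteq> carrier A" using X complemented_closed by blast
    then obtain i where i: "i \<in> complemented A" "coann A X = filter_gen A {i}"
      using I False Xm by blast
    have le_ki: "b \<sqsubseteq> k i \<longleftrightarrow> (\<forall>x \<in> X. b \<sqsubseteq> x)" if b: "b \<in> complemented A" for b
    proof -
      have "b \<sqsubseteq> k i \<longleftrightarrow> i \<sqsubseteq> k b"
        using complementary_antimono[OF k[OF b] complementary_sym[OF k[OF i(1)]]] .
      also have "\<dots> \<longleftrightarrow> k b \<in> coann A X"
        using complemented_closed[OF kB[OF b]] by (simp add: i(2) filter_gen_complemented[OF i(1)])
      also have "\<dots> \<longleftrightarrow> (\<forall>x \<in> X. x \<squnion> k b = \<top>)"
        using complemented_closed[OF kB[OF b]] join_comm[of A "k b"] by (simp add: coann_def)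
      also have "\<dots> \<longleftrightarrow> (\<forall>x \<in> X. b \<sqsubseteq> x)"
        using complementary_le_iff[OF k[OF b]] X complemented_closed by (meson subsetD)
      finally show ?thesis .
    qed
    have below: "k i \<sqsubseteq> x" if "x \<in> X" for x
      using le_ki[OF kB[OF i(1)]] le_refl[OF complemented_closed[OF kB[OF i(1)]]] that by simp
    have above: "x \<sqsubseteq> s" if "x \<in> X" for x
      using s_le[of s] s(1) complemented_closed le_refl[of s] that by simp
    have "greatest ?B (k i) (Lower ?B X)"
      using below kB[OF i(1)] le_ki X by (auto simp: greatest_def Lower_def subset_iff)
    moreover have "least ?B s (Upper ?B X)"
      using above s(1) s_le complemented_closed X
      by (auto simp: least_def Upper_def subset_iff)
    ultimately show ?thesis by blast
  qed
qed

text \<open>The generator is the supremum in the center of the generators \<open>g x\<close> of the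
  single coannihilators. That supremum is compared only with complemented bounds, so an arbitrary
  upper bound \<open>a\<close> has to be replaced by a complemented one below it.\<close>

lemma coann_principal:
  assumes co_Stone: "\<And>x. x \<in> carrier A \<Longrightarrow> \<exists>e \<in> complemented A. coann A {x} = filter_gen A {e}"
    and complete: "m_complete m (boolean_center A)"
    and X: "X \<subseteq> carrier A" "|X| \<le>o m"
  shows "\<exists>e \<in> complemented A. coann A X = filter_gen A {e}"
proof -
  let ?B = "boolean_center A"
  obtain g where g: "g x \<in> complemented A" "coann A {x} = filter_gen A {g x}"
    if "x \<in> carrier A" for x
    using co_Stone by metis
  have join_iff: "a \<squnion> x = \<top> \<longleftrightarrow> g x \<sqsubseteq> a" if "a \<in> carrier A" "x \<in> carrier A" for a x
    using g[OF that(2)] that(1) by (auto simp: coann_def filter_gen_complemented)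
  have gX: "g ` X \<subseteq> complemented A" using g X by blast
  then obtain s where "least ?B s (Upper ?B (g ` X))"
    using complete ordLeq_transitive[OF card_of_image X(2)] unfolding m_complete_def
    by (metis partial_object.select_convs(1) partial_object.surjective partial_object.update_convs(1))
  then have s: "s \<in> complemented A" "\<And>x. x \<in> X \<Longrightarrow> g x \<sqsubseteq> s"
    and least: "\<And>b. \<lbrakk>b \<in> complemented A; \<And>x. x \<in> X \<Longrightarrow> g x \<sqsubseteq> b\<rbrakk> \<Longrightarrow> s \<sqsubseteq> b"
    using gX by (auto simp: least_def Upper_def)
  have "s \<sqsubseteq> a \<longleftrightarrow> (\<forall>x \<in> X. a \<squnion> x = \<top>)" if a: "a \<in> carrier A" for a
  proof
    assume sa: "s \<sqsubseteq> a"
    have "g x \<sqsubseteq> a" if "x \<in> X" for x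
      using le_trans[OF s(2)[OF that] sa] a s(1) complemented_closed gX that by blast
    then show "\<forall>x \<in> X. a \<squnion> x = \<top>" using join_iff a X(1) by blast
  next
    assume aX: "\<forall>x \<in> X. a \<squnion> x = \<top>"
    \<comment> \<open>\<open>a\<close> need not be complemented; the complement \<open>c\<close> of \<open>g a\<close>, which generates \<open>a\<^sup>\<top>\<^sup>\<top>\<close>, lies
        below \<open>a\<close> and is still an upper bound.\<close>
    obtain c where c: "complementary A (g a) c" using g(1)[OF a] complemented_iff by blast
    have cl: "c \<in> carrier A" using complementary_closed[OF c] by simp
    have ca: "c \<sqsubseteq> a"
      using complementary_le_iff[OF complementary_sym[OF c] a] join_iff[of "g a" a] a
        complementary_closed[OF c] join_comm[of A a "g a"] le_refl[of "g a"] by simp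
    \<comment> \<open>With \<open>d\<close> complementary to \<open>g x\<close>, the bound
      \<open>g x \<sqsubseteq> a\<close> turns into \<open>a \<squnion> d = \<top>\<close>, then
      into \<open>g a \<sqsubseteq> d\<close>; taking complements gives the claim.\<close>
    have "g x \<sqsubseteq> c" if x: "x \<in> X" for x
    proof -
      obtain d where d: "complementary A (g x) d" using gX x complemented_iff by blast
      have "g x \<sqsubseteq> a" using join_iff[OF a] aX x X(1) by blast
      then have "a \<squnion> d = \<top>" using complementary_le_iff[OF d a] by simp
      then have "g a \<sqsubseteq> d"
        using join_iff[OF _ a, of d] complementary_closed[OF d] join_comm[of A a d] by simp
      then show ?thesis using complementary_antimono[OF c complementary_sym[OF d]] by simp
    qed
    then have "s \<sqsubseteq> c" using least complementary_complemented[OF c] by blast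
    then show "s \<sqsubseteq> a" using le_trans[OF _ ca] cl a s(1) complemented_closed by blast
  qed
  then have "coann A X = filter_gen A {s}"
    by (auto simp: coann_def filter_gen_complemented[OF s(1)])
  then show ?thesis using s(1) by blast
qed

section \<open>The lattice of double coannihilators\<close>

text \<open>If \<open>e\<close> generates \<open>coann A {a}\<close>, its complement generates the
  double coannihilator. Conversely, the filter generated by a complemented \<open>e\<close> is the
  double coannihilator of \<open>e\<close> itself.\<close>

lemma coann_coann_image:
  assumes co_Stone: "\<And>x. x \<in> carrier A \<Longrightarrow> \<exists>e \<in> complemented A. coann A {x} = filter_gen A {e}"
  shows "{coann A (coann A {a}) |a. a \<in> carrier A} = (\<lambda>e. filter_gen A {e}) ` complemented A"
proof (intro subset_antisym subsetI)
  fix F assume "F \<in> {coann A (coann A {a}) |a. a \<in> carrier A}"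
  then obtain a where a: "a \<in> carrier A" "F = coann A (coann A {a})" by blast
  obtain e f where "complementary A e f" "coann A {a} = filter_gen A {e}"
    using co_Stone[OF a(1)] complemented_iff by blast
  then show "F \<in> (\<lambda>e. filter_gen A {e}) ` complemented A"
    using a(2) coann_filter_gen_complementary complementary_complemented(2) by auto
next
  fix F assume "F \<in> (\<lambda>e. filter_gen A {e}) ` complemented A"
  then obtain e f where e: "complementary A e f" "F = filter_gen A {e}"
    using complemented_iff by blast
  have "coann A (coann A {e}) = F"
    using coann_complementary[OF complementary_sym[OF e(1)]]
      coann_filter_gen_complementary[OF complementary_sym[OF e(1)]] e(2) by simp
  then show "F \<in> {coann A (coann A {a}) |a. a \<in> carrier A}"
    using complementary_closed(1)[OF e(1)] by blast
qed

text \<open>Everything is pulled back to generators, where filter meet becomes join and filter join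
  becomes meet; complements of filters come from complements in the center.\<close>

lemma filter_gen_image_boolean:
  fixes S
  defines "S \<equiv> (\<lambda>e. filter_gen A {e}) ` complemented A"
  shows "sublattice S (filter_lattice A)"
    and "boolean_lattice ((filter_lattice A)\<lparr>carrier := S\<rparr>)"
proof -
  let ?L = "filter_lattice A"
  interpret L: bounded_lattice ?L by (rule filter_lattice_is_bounded_lattice)
  have fil: "rl_filter A (filter_gen A {e})" if "e \<in> complemented A" for e
    using rl_filter_gen that complemented_closed by simp
  have join: "filter_gen A {e} \<squnion>\<^bsub>?L\<^esub> filter_gen A {f} = filter_gen A {e \<sqinter> f}"
    and meet: "filter_gen A {e} \<sqinter>\<^bsub>?L\<^esub> filter_gen A {f} = filter_gen A {e \<squnion> f}"
    if "e \<in> complemented A" "f \<in> complemented A" for e f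
    using that by (simp_all add: filter_lattice_join filter_lattice_meet fil filter_join_gen
        filter_gen_Int)
  show sub: "sublattice S ?L"
    unfolding sublattice_def
  proof (intro conjI ballI)
    show "S \<subseteq> carrier ?L" unfolding S_def using fil by (auto simp: filter_lattice_def)
  qed (auto simp: S_def join meet complemented_join complemented_meet)
  have compl: "\<exists>f \<in> complemented A. e \<squnion> f = \<top> \<and> e \<sqinter> f = \<bottom>" if "e \<in> complemented A" for e
    using boolean_lattice.complement_exists[OF boolean_lattice_center] that sublattice_complemented
    by (simp add: join_sublattice meet_sublattice bottom_sublattice top_sublattice
        top_complemented bottom_complemented cong: bex_cong)
  show "boolean_lattice (?L\<lparr>carrier := S\<rparr>)"
  proof (rule L.boolean_lattice_sublatticeI[OF sub])
    show "\<top>\<^bsub>?L\<^esub> \<in> S" "\<bottom>\<^bsub>?L\<^esub> \<in> S"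
      unfolding S_def filter_lattice_top filter_lattice_bottom
      using filter_gen_bottom filter_gen_top bottom_complemented top_complemented by auto
  next
    fix x y z assume "x \<in> S" "y \<in> S" "z \<in> S"
    then show "x \<sqinter>\<^bsub>?L\<^esub> (y \<squnion>\<^bsub>?L\<^esub> z) = (x \<sqinter>\<^bsub>?L\<^esub> y) \<squnion>\<^bsub>?L\<^esub> (x \<sqinter>\<^bsub>?L\<^esub> z)"
      unfolding S_def by (auto simp: join meet complemented_join complemented_meet
          join_meet_distrib_complemented complemented_closed)
  next
    fix x assume "x \<in> S"
    then obtain e where e: "e \<in> complemented A" "x = filter_gen A {e}" unfolding S_def by blast
    then obtain f where "f \<in> complemented A" "e \<squnion> f = \<top>" "e \<sqinter> f = \<bottom>" using compl by blast
    then show "\<exists>y \<in> S. x \<squnion>\<^bsub>?L\<^esub> y = \<top>\<^bsub>?L\<^esub> \<and> x \<sqinter>\<^bsub>?L\<^esub> y = \<bottom>\<^bsub>?L\<^esub>"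
      unfolding S_def filter_lattice_top filter_lattice_bottom using e
      by (auto simp: join meet filter_gen_bottom filter_gen_top intro!: bexI[of _ f])
  qed
qed

lemma co_Stone_if_boolean:
  fixes S
  defines "S \<equiv> {coann A (coann A {a}) |a. a \<in> carrier A}"
  assumes sub: "sublattice S (filter_lattice A)"
    and bool: "boolean_lattice ((filter_lattice A)\<lparr>carrier := S\<rparr>)"
    and a: "a \<in> carrier A"
  shows "\<exists>e \<in> complemented A. coann A {a} = filter_gen A {e}"
proof -
  let ?L = "filter_lattice A"
  interpret L: bounded_lattice ?L by (rule filter_lattice_is_bounded_lattice)
  have S_mem: "coann A (coann A {x}) \<in> S" if "x \<in> carrier A" for x
    unfolding S_def using that by blast
  \<comment> \<open>\<open>sublattice\<close> does not include the bounds. Those of the filter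
    lattice arise as double coannihilators of \<open>\<top>\<close> and \<open>\<bottom>\<close>, so
    complements inside \<open>S\<close> are complements among all filters.\<close>
  have "{\<top>} \<in> S"
    using S_mem[OF top_closed] by (simp add: coann_top coann_carrier)
  moreover have "carrier A \<in> S"
  proof -
    have "coann A {\<bottom>} = {\<top>}"
      using coann_complementary[OF complementary_top_bottom] filter_gen_top by simp
    then show ?thesis using S_mem[OF bottom_closed] by (simp add: coann_top)
  qed
  ultimately have top_bot: "\<top>\<^bsub>?L\<^esub> \<in> S" "\<bottom>\<^bsub>?L\<^esub> \<in> S"
    by (simp_all add: filter_lattice_top filter_lattice_bottom)
  let ?F = "coann A (coann A {a})"
  have F: "?F \<in> S" using S_mem[OF a] .
  then obtain G where G: "G \<in> S" "?F \<squnion>\<^bsub>?L\<^esub> G = \<top>\<^bsub>?L\<^esub>" "?F \<sqinter>\<^bsub>?L\<^esub> G = \<bottom>\<^bsub>?L\<^esub>"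
    using boolean_lattice.complement_exists[OF bool, of ?F]
    by (auto simp: L.join_sublattice[OF sub top_bot] L.meet_sublattice[OF sub top_bot]
        L.bottom_sublattice[OF sub top_bot] L.top_sublattice[OF sub top_bot])
  have fil: "rl_filter A ?F" "rl_filter A G"
    using sub F G(1) by (auto simp: sublattice_def filter_lattice_def)
  have "filter_join A ?F G = carrier A" "?F \<inter> G = {\<top>}"
    using G(2,3) fil
    by (simp_all add: filter_lattice_join filter_lattice_meet filter_lattice_top
        filter_lattice_bottom)
  then obtain e f where ef: "complementary A e f" "?F = filter_gen A {e}"
    using complementary_filters[OF fil] by metis
  have "coann A {a} = filter_gen A {f}"
    using coann_coann_coann[of "{a}"] a coann_filter_gen_complementary[OF ef(1)] ef(2) by simp
  then show ?thesis using complementary_complemented(2)[OF ef(1)] by blast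
qed

text \<open>The map from \<open>e\<close> to its principal filter reverses the order, by
  \<open>filter_gen_subset_iff\<close>, and is onto the image.\<close>

lemma m_complete_filter_gen_image_iff:
  "m_complete m (boolean_center A) \<longleftrightarrow>
     m_complete m ((filter_lattice A)\<lparr>carrier := (\<lambda>e. filter_gen A {e}) ` complemented A\<rparr>)"
  by (rule m_complete_dual_iff[where h = "\<lambda>e. filter_gen A {e}"])
    (simp_all add: filter_gen_subset_iff filter_lattice_def)

end

section \<open>Combining the implications among the five conditions\<close>

theorem theorem3p9:
  fixes A :: "('a, 'b) residuated_scheme" and m :: "'c rel"
  assumes "residuated_lattice A"
    and "Card_order m" and "cinfinite m"
  shows
   "let I = (\<forall>X. X \<subseteq> carrier A \<and> X \<noteq> {} \<and> |X| \<le>o m \<longrightarrow>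
               (\<exists>e \<in> complemented A. coann A X = filter_gen A {e}));
        II = (co_Stone_residuated_lattice A \<and>
               boolean_lattice (boolean_center A) \<and> m_complete m (boolean_center A));
        ATT = {coann A (coann A {a}) |a. a \<in> carrier A};
        III = (sublattice ATT (filter_lattice A) \<and>
               boolean_lattice ((filter_lattice A)\<lparr>carrier := ATT\<rparr>) \<and>
               m_complete m ((filter_lattice A)\<lparr>carrier := ATT\<rparr>));
        IV = ((\<forall>a \<in> carrier A. \<forall>b \<in> carrier A.
                 coann A {a \<squnion>\<^bsub>A\<^esub> b} = filter_join A (coann A {a}) (coann A {b})) \<and>
              (\<forall>X. X \<subseteq> carrier A \<and> X \<noteq> {} \<and> |X| \<le>o m \<longrightarrow>
                 (\<exists>x \<in> carrier A. coann A (coann A X) = coann A {x})));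
        V = (\<forall>X. X \<subseteq> carrier A \<and> X \<noteq> {} \<and> |X| \<le>o m \<longrightarrow>
               filter_join A (coann A X) (coann A (coann A X)) = carrier A)
    in (I \<longleftrightarrow> II) \<and> (II \<longleftrightarrow> III) \<and> (III \<longleftrightarrow> IV) \<and> (IV \<longleftrightarrow> V)"
proof -
  interpret residuated_lattice A by fact
  \<comment> \<open>An infinite \<open>m\<close> admits singletons, so conditions on sets
    \<open>X\<close> specialize to single elements; (I) then yields the co-Stone property.\<close>
  have singleton: "|{x}| \<le>o m" for x :: 'a
    using Card_order_singl_ordLeq[OF assms(2), of x] assms(3) by (fastforce simp: cinfinite_def)
  define I where "I \<longleftrightarrow> (\<forall>X. X \<subseteq> carrier A \<and> X \<noteq> {} \<and> |X| \<le>o m \<longrightarrow>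
               (\<exists>e \<in> complemented A. coann A X = filter_gen A {e}))"
  define II where "II \<longleftrightarrow> co_Stone_residuated_lattice A \<and>
               boolean_lattice (boolean_center A) \<and> m_complete m (boolean_center A)"
  define ATT where "ATT = {coann A (coann A {a}) |a. a \<in> carrier A}"
  define III where "III \<longleftrightarrow> sublattice ATT (filter_lattice A) \<and>
               boolean_lattice ((filter_lattice A)\<lparr>carrier := ATT\<rparr>) \<and>
               m_complete m ((filter_lattice A)\<lparr>carrier := ATT\<rparr>)"
  define IV where "IV \<longleftrightarrow> (\<forall>a \<in> carrier A. \<forall>b \<in> carrier A.
                 coann A {a \<squnion>\<^bsub>A\<^esub> b} = filter_join A (coann A {a}) (coann A {b})) \<and>
              (\<forall>X. X \<subseteq> carrier A \<and> X \<noteq> {} \<and> |X| \<le>o m \<longrightarrow>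
                 (\<exists>x \<in> carrier A. coann A (coann A X) = coann A {x}))"
  define V where "V \<longleftrightarrow> (\<forall>X. X \<subseteq> carrier A \<and> X \<noteq> {} \<and> |X| \<le>o m \<longrightarrow>
               filter_join A (coann A X) (coann A (coann A X)) = carrier A)"
  let ?co_Stone = "\<forall>x \<in> carrier A. \<exists>e \<in> complemented A. coann A {x} = filter_gen A {e}"
  have co_Stone_iff: "co_Stone_residuated_lattice A \<longleftrightarrow> ?co_Stone"
    using residuated_lattice_axioms
    by (auto simp: co_Stone_residuated_lattice_def co_Stone_residuated_lattice_axioms_def)
  have I_co_Stone: "?co_Stone" if I
    using that singleton unfolding I_def by simp
  have "I \<longleftrightarrow> V"
    unfolding I_def V_def by (auto simp: filter_join_coann_iff)
  moreover have "I \<longleftrightarrow> II"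
  proof
    assume I
    then have "m_complete m (boolean_center A)"
      unfolding I_def by (intro m_complete_center) blast
    then show II
      unfolding II_def using I_co_Stone[OF \<open>I\<close>] co_Stone_iff boolean_lattice_center by blast
  next
    assume II
    then show I
      unfolding I_def II_def co_Stone_iff using coann_principal by blast
  qed
  moreover have "II \<longleftrightarrow> III"
  proof
    assume II
    then have cs: ?co_Stone and m: "m_complete m (boolean_center A)"
      unfolding II_def co_Stone_iff by blast+
    have ATT: "ATT = (\<lambda>e. filter_gen A {e}) ` complemented A"
      unfolding ATT_def using cs by (intro coann_coann_image) blast
    show III
      unfolding III_def ATT using filter_gen_image_boolean m m_complete_filter_gen_image_iff by blast
  next
    assume III
    \<comment> \<open>The co-Stone property comes first, since it is what identifies
      \<open>ATT\<close> with the image of the center, along which completeness travels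
      back.\<close>
    then have cs: ?co_Stone and m: "m_complete m ((filter_lattice A)\<lparr>carrier := ATT\<rparr>)"
      unfolding III_def ATT_def using co_Stone_if_boolean by blast+
    have ATT: "ATT = (\<lambda>e. filter_gen A {e}) ` complemented A"
      unfolding ATT_def using cs by (intro coann_coann_image) blast
    show II
      unfolding II_def co_Stone_iff
      using cs boolean_lattice_center m m_complete_filter_gen_image_iff unfolding ATT by blast
  qed
  moreover have "IV \<longleftrightarrow> V"
  proof
    assume IV
    then have join: "coann A {a \<squnion>\<^bsub>A\<^esub> b} = filter_join A (coann A {a}) (coann A {b})"
        if "a \<in> carrier A" "b \<in> carrier A" for a b
      unfolding IV_def using that by blast
    have ex: "\<exists>x \<in> carrier A. coann A (coann A X) = coann A {x}"
        if "X \<subseteq> carrier A" "X \<noteq> {}" "|X| \<le>o m" for X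
      using \<open>IV\<close> that unfolding IV_def by blast
    show V
      unfolding V_def
    proof (intro allI impI, elim conjE)
      fix X assume X: "X \<subseteq> carrier A" "X \<noteq> {}" "|X| \<le>o m"
      obtain x where x: "x \<in> carrier A" "coann A (coann A X) = coann A {x}" using ex[OF X] by blast
      obtain y where "y \<in> carrier A" "coann A (coann A {x}) = coann A {y}"
        using ex[of "{x}"] x(1) singleton by auto
      then show "filter_join A (coann A X) (coann A (coann A X)) = carrier A"
        using filter_join_coann_if_coann_coann[OF join X(1) x] by blast
    qed
  next
    assume V
    then have I using \<open>I \<longleftrightarrow> V\<close> by blast
    have "coann A {a \<squnion>\<^bsub>A\<^esub> b} = filter_join A (coann A {a}) (coann A {b})"
      if "a \<in> carrier A" "b \<in> carrier A" for a b
      using I_co_Stone[OF \<open>I\<close>] that coann_join by meson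
    moreover have "\<exists>x \<in> carrier A. coann A (coann A X) = coann A {x}"
      if "X \<subseteq> carrier A" "X \<noteq> {}" "|X| \<le>o m" for X
    proof -
      obtain e where e: "e \<in> complemented A" "coann A X = filter_gen A {e}"
        using \<open>I\<close> \<open>X \<subseteq> carrier A\<close> \<open>X \<noteq> {}\<close> \<open>|X| \<le>o m\<close> unfolding I_def by blast
      then show ?thesis
        \<comment> \<open>The generator \<open>e\<close> itself is the witness: the coannihilator of
          its principal filter is \<open>coann A {e}\<close>.\<close>
        using coann_filter_gen[of "{e}"] complemented_closed by (intro bexI[of _ e]) simp_all
    qed
    ultimately show IV unfolding IV_def by blast
  qed
  ultimately show ?thesis
    unfolding Let_def I_def[symmetric] II_def[symmetric] ATT_def[symmetric] III_def[symmetric]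
      IV_def[symmetric] V_def[symmetric] by blast
qed

end
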